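(* Let $G=(V,E,d)$ be a bicolored graph and let $\mathcal{C}\subseteq\{1,\dots,d\}^V$ be a set of legal vertex colorings. Then the system of Boolean constraints $\mathrm{TutteEncoding}(G,\mathcal{C})$ (defined in the context) is satisfiable if and only if $G$ does not satisfy the FORALL-PMVC condition with respect to $\mathcal{C}$, i.e., if and only if there exists a coloring $c\in\mathcal{C}$ such that $G$ has no perfect matching with inherited vertex coloring $c$.
   Context: A bicolored graph is a tuple $G=(V,E,d)$ where $V$ is a finite set of vertices, $d$ is the number of colors, and $E$ is a finite set of undirected bicolored edges. Each edge $e\in E$ connects two distinct vertices $u,v$ (no self-loops) and has a color $c_u^e\in\{1,\dots,d\}$ at the end $u$ and a color $c_v^e\in\{1,\dots,d\}$ at the end $v$; we write $e=\{(u,c_u^e),(v,c_v^e)\}$. The two colors may be equal or different, and several edges (with different colorings) between the same pair of vertices are allowed. A vertex coloring is a map $c:V\to\{1,\dots,d\}$. A perfect matching of $G$ is a set $P\subseteq E$ such that each $v\in V$ is incident to exactly one edge of $P$. Its inherited vertex coloring $c^P$ is given by $c^P(v)=c_v^e$, where $e$ is the unique edge of $P$ incident to $v$. FORALL-PMVC condition with respect to $\mathcal{C}$: for each $c\in\mathcal{C}$, $G$ has at least one perfect matching with inherited vertex coloring $c$. $\mathrm{TutteEncoding}(G,\mathcal{C})$ is a conjunction of constraints over the following Boolean variables (True is interpreted as $1$ and False as $0$ in sums): - $\mathtt{vc}_v^i$ for $v\in V$, $1\le i\le d$; - $T_v$ for $v\in V$; - $\mathtt{e}_{uv}^{ab}$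 for each edge $\{(u,a),(v,b)\}\in E$ (one variable per edge); - $\mathtt{cc}_v^i$ for $v\in V$, $1\le i\le |V|$; - $\mathtt{Odd}_i$ for $1\le i\le |V|$. The constraints are the following, where $\mathrm{ExactOne}(X)$ means that exactly one variable of $X$ is True: 1. ValidColoring: for each $v\in V$, $\mathrm{ExactOne}(\{\mathtt{vc}_v^i\}_{1\le i\le d})$. 2. LegalColoring: a set of constraints on the variables $\mathtt{vc}_v^i$ that defines $\mathcal{C}$; that is, an assignment satisfying ValidColoring satisfies LegalColoring iff the coloring $c$ given by $c(v)=i\Leftrightarrow \mathtt{vc}_v^i=\text{True}$ belongs to $\mathcal{C}$. 3. RemainingEdges: for each $\{(u,a),(v,b)\}\in E$, $\mathtt{e}_{uv}^{ab}\leftrightarrow(\neg T_v\wedge\neg T_u\wedge \mathtt{vc}_u^a\wedge \mathtt{vc}_v^b)$. 4. ConnectedComponent: for each $\{(u,a),(v,b)\}\in E$, $\mathtt{e}_{uv}^{ab}\to\bigwedge_{1\le i\le |V|}(\mathtt{cc}_v^i\leftrightarrow \mathtt{cc}_u^i)$. 5. ValidComponent: for each $v\in V$, $\mathrm{ExactOne}(\{\mathtt{cc}_v^i\}_{1\le i\le |V|}\cup\{T_v\})$. 6. Odd: for each $1\le i\le |V|$, $\mathtt{Odd}_i\leftrightarrow\bigoplus_{v\in V}\mathtt{cc}_v^i$ (exclusive or). 7. TutteCondition: $\sum_{i=1}^{|V|}\mathtt{Odd}_i>\sum_{v\in V}T_v$. *)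

theory Defs
  imports Main "HOL-Library.FuncSet"
begin

section \<open>Bicolored graphs\<close>

text \<open>An edge is the two-element set of its coloured ends, so parallel edges between
  the same two vertices are told apart by their colours.\<close>

type_synonym 'v bicolored_edge = "('v \<times> nat) set"

record 'v bicolored_graph =
  verts :: "'v set"
  edges :: "'v bicolored_edge set"
  ncolors :: nat

definition bicolored_graph :: "'v bicolored_graph \<Rightarrow> bool" where
  "bicolored_graph G \<longleftrightarrow> finite (verts G) \<and> finite (edges G) \<and>
     (\<forall>e\<in>edges G. \<exists>u\<in>verts G. \<exists>v\<in>verts G. \<exists>a\<in>{1..ncolors G}. \<exists>b\<in>{1..ncolors G}.
        u \<noteq> v \<and> e = {(u, a), (v, b)})"

definition vertex_colorings :: "'v bicolored_graph \<Rightarrow> ('v \<Rightarrow> nat) set" where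
  "vertex_colorings G = verts G \<rightarrow>\<^sub>E {1..ncolors G}"

definition incident :: "'v \<Rightarrow> 'v bicolored_edge \<Rightarrow> bool" where
  "incident v e \<longleftrightarrow> (\<exists>a. (v, a) \<in> e)"

definition end_color :: "'v bicolored_edge \<Rightarrow> 'v \<Rightarrow> nat" where
  "end_color e v = (THE a. (v, a) \<in> e)"

definition perfect_matching :: "'v bicolored_graph \<Rightarrow> 'v bicolored_edge set \<Rightarrow> bool" where
  "perfect_matching G P \<longleftrightarrow> P \<subseteq> edges G \<and> (\<forall>v\<in>verts G. \<exists>!e. e \<in> P \<and> incident v e)"

definition inherited_coloring ::
  "'v bicolored_graph \<Rightarrow> 'v bicolored_edge set \<Rightarrow> 'v \<Rightarrow> nat" where
  "inherited_coloring G P = (\<lambda>v\<in>verts G. end_color (THE e. e \<in> P \<and> incident v e) v)"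

definition forall_pmvc :: "'v bicolored_graph \<Rightarrow> ('v \<Rightarrow> nat) set \<Rightarrow> bool" where
  "forall_pmvc G C \<longleftrightarrow>
     (\<forall>c\<in>C. \<exists>P. perfect_matching G P \<and> inherited_coloring G P = c)"

section \<open>Boolean constraints\<close>

text \<open>A constraint over variables of type \<open>'x\<close> is represented by its truth function on
  assignments, and a system (conjunction) of constraints by a set of them.\<close>

type_synonym 'x constraint = "('x \<Rightarrow> bool) \<Rightarrow> bool"

definition satisfies :: "('x \<Rightarrow> bool) \<Rightarrow> 'x constraint set \<Rightarrow> bool" where
  "satisfies A \<Phi> \<longleftrightarrow> (\<forall>\<phi>\<in>\<Phi>. \<phi> A)"

definition satisfiable :: "'x constraint set \<Rightarrow> bool" where
  "satisfiable \<Phi> \<longleftrightarrow> (\<exists>A. satisfies A \<Phi>)"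

text \<open>The truth function depends on the variables in \<open>X\<close> only.\<close>

definition constraint_on :: "'x set \<Rightarrow> 'x constraint \<Rightarrow> bool" where
  "constraint_on X \<phi> \<longleftrightarrow> (\<forall>A B. (\<forall>x\<in>X. A x = B x) \<longrightarrow> \<phi> A = \<phi> B)"

definition ExactOne :: "'x set \<Rightarrow> 'x constraint" where
  "ExactOne X A \<longleftrightarrow> (\<exists>!x. x \<in> X \<and> A x)"

definition big_xor :: "('a \<Rightarrow> bool) \<Rightarrow> 'a set \<Rightarrow> bool" where
  "big_xor f S = Finite_Set.fold (\<lambda>x b. f x \<noteq> b) False S"

lemma big_xor_iff_odd:
  assumes "finite S"
  shows "big_xor f S \<longleftrightarrow> odd (card {x \<in> S. f x})"
proof -
  interpret comp_fun_commute "\<lambda>x b. f x \<noteq> b"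
    by standard (simp add: fun_eq_iff, blast)
  show ?thesis
    using assms
  proof (induction S)
    case empty
    then show ?case by (simp add: big_xor_def)
  next
    case (insert x S)
    have "big_xor f (insert x S) \<longleftrightarrow> f x \<noteq> big_xor f S"
      unfolding big_xor_def by (rule fold_insert[OF insert.hyps])
    also have "\<dots> \<longleftrightarrow> odd (card {y \<in> insert x S. f y})"
    proof (cases "f x")
      case True
      then have "{y \<in> insert x S. f y} = insert x {y \<in> S. f y}" by blast
      with True insert show ?thesis by simp
    next
      case False
      then have "{y \<in> insert x S. f y} = {y \<in> S. f y}" by blast
      with False insert show ?thesis by simp
    qed
    finally show ?case .
  qed
qed

section \<open>The encoding\<close>

datatype 'v tutte_var =
    VC 'v nat
  | T 'v
  | Edge "'v bicolored_edge"
  | CC 'v nat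
  | Odd nat

definition vc_vars :: "'v bicolored_graph \<Rightarrow> 'v tutte_var set" where
  "vc_vars G = {VC v i | v i. v \<in> verts G \<and> i \<in> {1..ncolors G}}"

definition ValidColoring :: "'v bicolored_graph \<Rightarrow> 'v tutte_var constraint set" where
  "ValidColoring G = {ExactOne {VC v i | i. i \<in> {1..ncolors G}} | v. v \<in> verts G}"

text \<open>\<open>\<Lambda>\<close> is an admissible choice of the constraints LegalColoring for \<open>C\<close>: the encoding
  does not prescribe these constraints, only the set of colorings they define.\<close>

definition defines_colorings ::
  "'v bicolored_graph \<Rightarrow> ('v \<Rightarrow> nat) set \<Rightarrow> 'v tutte_var constraint set \<Rightarrow> bool" where
  "defines_colorings G C \<Lambda> \<longleftrightarrow>
     (\<forall>\<phi>\<in>\<Lambda>. constraint_on (vc_vars G) \<phi>) \<and>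
     (\<forall>A. \<forall>c\<in>vertex_colorings G.
        satisfies A (ValidColoring G) \<and>
        (\<forall>v\<in>verts G. \<forall>i\<in>{1..ncolors G}. c v = i \<longleftrightarrow> A (VC v i)) \<longrightarrow>
        (satisfies A \<Lambda> \<longleftrightarrow> c \<in> C))"

definition RemainingEdges :: "'v bicolored_graph \<Rightarrow> 'v tutte_var constraint set" where
  "RemainingEdges G =
     {\<lambda>A. A (Edge {(u, a), (v, b)}) \<longleftrightarrow>
          \<not> A (T v) \<and> \<not> A (T u) \<and> A (VC u a) \<and> A (VC v b)
      | u a v b. {(u, a), (v, b)} \<in> edges G}"

definition ConnectedComponent :: "'v bicolored_graph \<Rightarrow> 'v tutte_var constraint set" where
  "ConnectedComponent G =
     {\<lambda>A. A (Edge {(u, a), (v, b)}) \<longrightarrow>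
          (\<forall>i\<in>{1..card (verts G)}. A (CC v i) \<longleftrightarrow> A (CC u i))
      | u a v b. {(u, a), (v, b)} \<in> edges G}"

definition ValidComponent :: "'v bicolored_graph \<Rightarrow> 'v tutte_var constraint set" where
  "ValidComponent G =
     {ExactOne ({CC v i | i. i \<in> {1..card (verts G)}} \<union> {T v}) | v. v \<in> verts G}"

definition OddConstraint :: "'v bicolored_graph \<Rightarrow> 'v tutte_var constraint set" where
  "OddConstraint G =
     {\<lambda>A. A (Odd i) \<longleftrightarrow> big_xor (\<lambda>v. A (CC v i)) (verts G) | i. i \<in> {1..card (verts G)}}"

definition TutteCondition :: "'v bicolored_graph \<Rightarrow> 'v tutte_var constraint" where
  "TutteCondition G A \<longleftrightarrow>
     (\<Sum>i=1..card (verts G). of_bool (A (Odd i)) :: nat) > (\<Sum>v\<in>verts G. of_bool (A (T v)))"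

definition TutteEncoding ::
  "'v bicolored_graph \<Rightarrow> 'v tutte_var constraint set \<Rightarrow> 'v tutte_var constraint set" where
  "TutteEncoding G \<Lambda> =
     ValidColoring G \<union> \<Lambda> \<union> RemainingEdges G \<union> ConnectedComponent G \<union>
     ValidComponent G \<union> OddConstraint G \<union> {TutteCondition G}"

text \<open>Admissible constraints exist for every set of colorings.\<close>

lemma defines_colorings_exists: "\<exists>\<Lambda>. defines_colorings G C \<Lambda>"
proof -
  define m where
    "m A c \<longleftrightarrow> (\<forall>v\<in>verts G. \<forall>i\<in>{1..ncolors G}. c v = i \<longleftrightarrow> A (VC v i))"
    for A :: "'a tutte_var \<Rightarrow> bool" and c
  define \<phi> where "\<phi> A \<longleftrightarrow> (\<exists>c\<in>C \<inter> vertex_colorings G. m A c)" for A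
  have on: "constraint_on (vc_vars G) \<phi>"
  proof -
    have "m A c = m B c" if "\<forall>x\<in>vc_vars G. A x = B x" for A B c
      using that unfolding m_def vc_vars_def by blast
    then show ?thesis unfolding constraint_on_def \<phi>_def by blast
  qed
  have eq: "c = c'"
    if "c \<in> vertex_colorings G" "c' \<in> vertex_colorings G" "m A c" "m A c'" for A c c'
  proof -
    have c: "c \<in> verts G \<rightarrow>\<^sub>E {1..ncolors G}" "c' \<in> verts G \<rightarrow>\<^sub>E {1..ncolors G}"
      using that(1,2) by (simp_all add: vertex_colorings_def)
    show ?thesis
    proof (rule PiE_ext[OF c])
      fix v assume v: "v \<in> verts G"
      have i: "c v \<in> {1..ncolors G}" by (rule PiE_mem[OF c(1) v])
      then have "A (VC v (c v))" using that(3) v unfolding m_def by blast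
      then have "c' v = c v" using that(4) v i unfolding m_def by blast
      then show "c v = c' v" by simp
    qed
  qed
  have mem: "\<phi> A \<longleftrightarrow> c \<in> C" if "c \<in> vertex_colorings G" "m A c" for A c
    unfolding \<phi>_def using that eq by blast
  have "defines_colorings G C {\<phi>}"
    unfolding defines_colorings_def satisfies_def m_def[symmetric] using on mem by blast
  then show ?thesis ..
qed

end

theory Submission
  imports Defs
begin

text \<open>Fixing a coloring \<open>c\<close> leaves an ordinary graph, whose perfect matchings are those of \<open>G\<close>
  inheriting \<open>c\<close>; the remaining constraints assert a violation of Tutte's condition, so the claim
  is Tutte's theorem for this graph. It is proved in the Tutte-Berge form by induction on the vertex
  set: a vertex covered by every maximum matching is moved into the barrier, and if there is none
  then Gallai's lemma splits the graph into odd parts, each missing exactly one vertex.\<close>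

section \<open>Matchings as involutions\<close>

text \<open>A total involution whose fixed points are the unmatched vertices and everything outside
  \<open>V\<close>. Applying the second clause to \<open>m v\<close> places the partner in
  \<open>V\<close> as well.\<close>

definition matching_on :: "'v set \<Rightarrow> ('v \<Rightarrow> 'v \<Rightarrow> bool) \<Rightarrow> ('v \<Rightarrow> 'v) \<Rightarrow> bool" where
  "matching_on V E m \<longleftrightarrow> (\<forall>v. m (m v) = v) \<and> (\<forall>v. m v \<noteq> v \<longrightarrow> v \<in> V \<and> E v (m v))"

definition unmatched :: "'v set \<Rightarrow> ('v \<Rightarrow> 'v) \<Rightarrow> 'v set" where
  "unmatched V m = {v \<in> V. m v = v}"

definition max_matching :: "'v set \<Rightarrow> ('v \<Rightarrow> 'v \<Rightarrow> bool) \<Rightarrow> ('v \<Rightarrow> 'v) \<Rightarrow> bool" where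
  "max_matching V E m \<longleftrightarrow> matching_on V E m \<and>
     (\<forall>n. matching_on V E n \<longrightarrow> card (unmatched V m) \<le> card (unmatched V n))"

lemma finite_unmatched [simp]: "finite V \<Longrightarrow> finite (unmatched V m)"
  by (simp add: unmatched_def)

lemma matching_on_id: "matching_on V E (\<lambda>v. v)"
  by (simp add: matching_on_def)

lemma matching_on_mono: "matching_on V E m \<Longrightarrow> V \<subseteq> W \<Longrightarrow> matching_on W E m"
  by (auto simp: matching_on_def)

lemma matching_on_in:
  assumes "matching_on V E m" "v \<in> V"
  shows "m v \<in> V"
  using assms unfolding matching_on_def by metis

lemma ex_max_matching: "\<exists>m. max_matching V E m"
  using ex_has_least_nat[of "matching_on V E" _ "\<lambda>m. card (unmatched V m)"] matching_on_id
  unfolding max_matching_def by metis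

lemma max_matchingI:
  assumes "max_matching V E m" "matching_on V E n"
    and "card (unmatched V n) \<le> card (unmatched V m)"
  shows "max_matching V E n"
  using assms unfolding max_matching_def by (meson le_trans)

lemma max_matching_card_eq:
  assumes "max_matching V E m" "max_matching V E n"
  shows "card (unmatched V m) = card (unmatched V n)"
  using assms unfolding max_matching_def by (meson le_antisym)

text \<open>The orbits \<open>{v, m v}\<close> split the set into pairs; the induction removes one
  orbit.\<close>

lemma even_card_involution:
  assumes "finite X" and "\<And>v. v \<in> X \<Longrightarrow> m v \<in> X \<and> m (m v) = v \<and> m v \<noteq> v"
  shows "even (card X)"
  using assms
proof (induction X rule: finite_psubset_induct)
  case (psubset X)
  show ?case
  proof (cases "X = {}")
    case False
    then obtain x where x: "x \<in> X" by blast
    let ?Y = "X - {x, m x}"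
    have mx: "m x \<in> X" "m (m x) = x" "m x \<noteq> x" using psubset.prems[OF x] by auto
    have "even (card ?Y)"
    proof (rule psubset.IH)
      show "?Y \<subset> X" using x by blast
      fix v assume "v \<in> ?Y"
      then show "m v \<in> ?Y \<and> m (m v) = v \<and> m v \<noteq> v"
        using psubset.prems[of v] mx by auto
    qed
    moreover have "card X = card ?Y + card {x, m x}"
      using x mx psubset.hyps card_mono[of X "{x, m x}"] by (simp add: card_Diff_subset)
    moreover have "card {x, m x} = 2" using mx by simp
    ultimately show ?thesis by simp
  qed simp
qed

text \<open>Any two matchings of \<open>V\<close> therefore miss numbers of vertices of equal
  parity, which \<open>tutte_berge\<close> uses to enlarge a gap of one to two.\<close>

lemma even_card_matched:
  assumes "finite V" "matching_on V E m"
  shows "even (card V - card (unmatched V m))"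
proof -
  have "even (card (V - unmatched V m))"
  proof (rule even_card_involution)
    show "finite (V - unmatched V m)" using assms(1) by simp
    fix v assume "v \<in> V - unmatched V m"
    then show "m v \<in> V - unmatched V m \<and> m (m v) = v \<and> m v \<noteq> v"
      using assms(2) matching_on_in[OF assms(2)] by (auto simp: unmatched_def matching_on_def)
  qed
  moreover have "unmatched V m \<subseteq> V" by (auto simp: unmatched_def)
  ultimately show ?thesis using assms(1) by (simp add: card_Diff_subset)
qed

section \<open>Augmentation by one edge and Gallai's lemma\<close>

lemma matching_on_add_edge:
  assumes "matching_on V E m" "symp E" "x \<in> V" "y \<in> V" "m x = x" "m y = y" "E x y"
  shows "matching_on V E (m(x := y, y := x))"
  unfolding matching_on_def
proof (intro conjI allI impI)
  fix v
  have inv: "m (m v) = v" using assms(1) by (simp add: matching_on_def)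
  then show "(m(x := y, y := x)) ((m(x := y, y := x)) v) = v"
    using assms(5,6) by auto
next
  fix v assume "(m(x := y, y := x)) v \<noteq> v"
  then show "v \<in> V" "E v ((m(x := y, y := x)) v)"
    using assms sympD[OF assms(2,7)] by (auto simp: matching_on_def split: if_splits)
qed

lemma max_matching_nonadjacent:
  assumes "finite V" "symp E" "max_matching V E m"
    and "x \<in> V" "y \<in> V" "x \<noteq> y" "m x = x" "m y = y"
  shows "\<not> E x y"
proof
  assume "E x y"
  let ?n = "m(x := y, y := x)"
  have "matching_on V E ?n"
    using assms \<open>E x y\<close> by (intro matching_on_add_edge) (auto simp: max_matching_def)
  then have "card (unmatched V m) \<le> card (unmatched V ?n)"
    using assms(3) by (simp add: max_matching_def)
  moreover have "unmatched V ?n \<subset> unmatched V m"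
    using assms by (auto simp: unmatched_def)
  then have "card (unmatched V ?n) < card (unmatched V m)"
    using assms(1) by (intro psubset_card_mono) simp_all
  ultimately show False by simp
qed

text \<open>Gallai's lemma: "no maximum matching leaves both endpoints unmatched" is transitive.
  Among the maximum matchings missing \<open>t\<close> take one agreeing with \<open>m\<close> on as many vertices
  as possible; if it covers \<open>u\<close> and \<open>v\<close>, exchanging a single edge increases the agreement.\<close>

lemma gallai:
  assumes fin: "finite V" and sym: "symp E"
    and m: "max_matching V E m" and uv: "u \<in> V" "v \<in> V" "u \<noteq> v" "m u = u" "m v = v"
    and t: "t \<in> V" "max_matching V E n0" "n0 t = t"
  shows "\<exists>k. max_matching V E k \<and> k t = t \<and> (k u = u \<or> k v = v)"
proof (rule ccontr)
  assume neg: "\<not> ?thesis"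
  define agree where "agree n = {w \<in> V. n w = m w}" for n
  have "\<exists>n. (max_matching V E n \<and> n t = t) \<and>
      (\<forall>k. max_matching V E k \<and> k t = t \<longrightarrow> card (agree k) \<le> card (agree n))"
  proof (rule ex_has_greatest_nat)
    show "max_matching V E n0 \<and> n0 t = t" using t by simp
    show "\<forall>k. max_matching V E k \<and> k t = t \<longrightarrow> card (agree k) < Suc (card V)"
      using fin by (auto simp: agree_def less_Suc_eq_le intro: card_mono)
  qed
  then obtain n where n: "max_matching V E n" "n t = t"
    and best: "\<And>k. max_matching V E k \<Longrightarrow> k t = t \<Longrightarrow> card (agree k) \<le> card (agree n)"
    by blast
  have mm: "matching_on V E m" and nm: "matching_on V E n"
    using m n by (auto simp: max_matching_def)
  have minv: "m (m w) = w" and ninv: "n (n w) = w" for w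
    using mm nm by (auto simp: matching_on_def)
  \<comment> \<open>By \<open>neg\<close>, \<open>n\<close>, which misses \<open>t\<close>, covers
    \<open>u\<close> and \<open>v\<close>; and \<open>m\<close>, which misses \<open>u\<close>,
    covers \<open>t\<close>.\<close>
  have nu: "n u \<noteq> u" and nv: "n v \<noteq> v" and mt: "m t \<noteq> t" using neg n m uv by blast+
  let ?A = "unmatched V m" and ?B = "unmatched V n"
  \<comment> \<open>Maximum matchings miss equally many vertices. Since \<open>u\<close> and
    \<open>v\<close> are missed by \<open>m\<close> only, at least two vertices are missed by
    \<open>n\<close> only, and one of them is not \<open>t\<close>.\<close>
  have "card (?A - ?B) = card (?B - ?A)"
  proof -
    have "card ?A = card ?B" by (rule max_matching_card_eq[OF m n(1)])
    moreover have "card (?A - ?B) = card ?A - card (?A \<inter> ?B)"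
      "card (?B - ?A) = card ?B - card (?A \<inter> ?B)"
      using fin by (simp_all add: card_Diff_subset_Int Int_commute)
    ultimately show ?thesis by simp
  qed
  moreover have "2 \<le> card (?A - ?B)"
  proof -
    have "{u, v} \<subseteq> ?A - ?B" using uv nu nv by (auto simp: unmatched_def)
    then have "card {u, v} \<le> card (?A - ?B)" using fin by (intro card_mono) auto
    then show ?thesis using uv by simp
  qed
  ultimately have "\<not> ?B - ?A \<subseteq> {t}"
    using card_mono[of "{t}" "?B - ?A"] by auto
  then obtain x where x: "x \<in> V" "x \<noteq> t" "n x = x" "m x \<noteq> x"
    by (auto simp: unmatched_def)
  define y where "y = m x"
  define z where "z = n y"
  have y: "y \<in> V" "y \<noteq> x" "m y = x" "E x y"
    using x mm minv matching_on_in[OF mm] by (auto simp: y_def matching_on_def)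
  \<comment> \<open>Otherwise the edge joining \<open>x\<close> and \<open>y\<close> could be added
    to \<open>n\<close>.\<close>
  have ny: "n y \<noteq> y"
    using max_matching_nonadjacent[OF fin sym n(1)] x y by metis
  have z: "z \<in> V" "z \<noteq> y" "z \<noteq> x" "n z = y"
    using ny y x ninv matching_on_in[OF nm] unfolding z_def by metis+
  \<comment> \<open>The exchange: \<open>n\<close> gives up the edge between \<open>y\<close> and
    \<open>z\<close> for the one between \<open>x\<close> and \<open>y\<close>. Now \<open>z\<close>
    is missed instead of \<open>x\<close>, so \<open>k\<close> is still maximum.\<close>
  define k where "k = (n(y := y, z := z))(x := y, y := x)"
  have k0: "matching_on V E (n(y := y, z := z))"
  proof -
    have "n w \<noteq> y" if "w \<noteq> z" for w using ninv[of w] that by (auto simp: z_def)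
    moreover have "n w \<noteq> z" if "w \<noteq> y" for w using ninv[of w] that z by auto
    ultimately show ?thesis
      using nm unfolding matching_on_def by auto
  qed
  have km: "matching_on V E k"
    unfolding k_def using k0 sym x y z by (intro matching_on_add_edge) auto
  have "unmatched V k = insert z (?B - {x})"
    using x y z ny by (auto simp: k_def unmatched_def)
  moreover have "card (insert z (?B - {x})) = card ?B"
  proof -
    have "z \<notin> ?B" "x \<in> ?B" using z x by (auto simp: unmatched_def)
    then show ?thesis using fin card_Suc_Diff1[of ?B x] by simp
  qed
  ultimately have "max_matching V E k" using max_matchingI[OF n(1) km] by simp
  moreover have "k t = t" using n ny x by (auto simp: k_def)
  ultimately have "card (agree k) \<le> card (agree n)" by (rule best)
  \<comment> \<open>\<open>k\<close> gains agreement at \<open>x\<close>. Nothing is lost at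
    \<open>y\<close> and \<open>z\<close>, where \<open>n\<close> differs from \<open>m\<close>:
    \<open>n y = z\<close> but \<open>m y = x\<close>, and \<open>n z = y\<close> but
    \<open>m z\<close> is not \<open>y\<close>.\<close>
  moreover have "agree n \<subset> agree k"
  proof (rule psubsetI)
    have "m z \<noteq> y" using minv y z by metis
    moreover have "n y \<noteq> x" using z by (simp add: z_def)
    ultimately show "agree n \<subseteq> agree k"
      using x y z by (auto simp: agree_def k_def y_def[symmetric])
    have "x \<in> agree k" "x \<notin> agree n"
      using x y by (auto simp: agree_def k_def y_def[symmetric])
    then show "agree n \<noteq> agree k" by blast
  qed
  ultimately show False
    using psubset_card_mono[of "agree k" "agree n"] fin by (auto simp: agree_def)
qed

section \<open>The Tutte-Berge theorem\<close>

definition label_class :: "'v set \<Rightarrow> 'v set \<Rightarrow> ('v \<Rightarrow> 'a) \<Rightarrow> 'a \<Rightarrow> 'v set" where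
  "label_class V S f i = {v \<in> V - S. f v = i}"

text \<open>Labels stand in for connected components of the graph without \<open>S\<close>: a label class is a
  union of components, and if it is odd then so is one of these components.\<close>

definition edge_constant :: "'v set \<Rightarrow> ('v \<Rightarrow> 'v \<Rightarrow> bool) \<Rightarrow> ('v \<Rightarrow> 'a) \<Rightarrow> bool" where
  "edge_constant X E f \<longleftrightarrow> (\<forall>u\<in>X. \<forall>v\<in>X. E u v \<longrightarrow> f u = f v)"

text \<open>The easy half of Tutte's theorem: an odd class cannot be paired up internally, so some
  vertex of it has its partner in \<open>S\<close>, and different classes use different
  partners.\<close>

lemma odd_classes_le_card:
  assumes fin: "finite V" and S: "S \<subseteq> V" and m: "matching_on V E m" "unmatched V m = {}"
    and f: "edge_constant (V - S) E f"
  shows "card {i \<in> I. odd (card (label_class V S f i))} \<le> card S"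
proof -
  let ?I = "{i \<in> I. odd (card (label_class V S f i))}"
  have "\<exists>v\<in>V. f v = i \<and> m v \<in> S" if i: "i \<in> ?I" for i
  proof (rule ccontr)
    assume neg: "\<not> ?thesis"
    \<comment> \<open>If no partner lies in \<open>S\<close>, \<open>edge_constant\<close> keeps
      partners inside the class, and \<open>m\<close> is a fixed-point-free involution of
      it.\<close>
    have "even (card (label_class V S f i))"
    proof (rule even_card_involution)
      show "finite (label_class V S f i)" using fin by (simp add: label_class_def)
      fix v assume "v \<in> label_class V S f i"
      then have v: "v \<in> V" "v \<notin> S" "f v = i" by (auto simp: label_class_def)
      have "m v \<noteq> v" using m(2) v by (auto simp: unmatched_def)
      moreover have "E v (m v)" "m (m v) = v"
        using m(1) \<open>m v \<noteq> v\<close> by (auto simp: matching_on_def)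
      moreover have "m v \<in> V" "m v \<notin> S"
        using neg v matching_on_in[OF m(1)] by auto
      ultimately show "m v \<in> label_class V S f i \<and> m (m v) = v \<and> m v \<noteq> v"
        using f v by (auto simp: label_class_def edge_constant_def)
    qed
    then show False using i by simp
  qed
  then obtain g where g: "\<And>i. i \<in> ?I \<Longrightarrow> g i \<in> V \<and> f (g i) = i \<and> m (g i) \<in> S" by metis
  show ?thesis
  proof (rule card_inj_on_le)
    show "inj_on (\<lambda>i. m (g i)) ?I"
    proof (rule inj_onI)
      fix i j assume ij: "i \<in> ?I" "j \<in> ?I" and eq: "m (g i) = m (g j)"
      from eq have "g i = g j" using m(1) unfolding matching_on_def by metis
      then show "i = j" using g[OF ij(1)] g[OF ij(2)] by metis
    qed
    show "(\<lambda>i. m (g i)) ` ?I \<subseteq> S" using g by blast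
    show "finite S" using fin S finite_subset by blast
  qed
qed

text \<open>If every vertex is missed by some maximum matching, then by Gallai's lemma the relation of
  never being missed together is an equivalence. Each of its classes is closed under every
  maximum matching and contains exactly one unmatched vertex, hence is odd.\<close>

lemma tutte_berge_no_essential:
  assumes fin: "finite V" and sym: "symp E" and m: "max_matching V E m"
    and all: "\<And>v. v \<in> V \<Longrightarrow> \<exists>n. max_matching V E n \<and> n v = v"
  shows "\<exists>f. f ` V \<subseteq> V \<and> edge_constant V E f \<and>
    card (unmatched V m) \<le> card {i \<in> V. odd (card (label_class V {} f i))}"
proof -
  \<comment> \<open>Equality is a separate case because by \<open>all\<close> each vertex is missed
    by some maximum matching, so the negated condition fails for \<open>u = v\<close>.\<close>
  define R where "R u v \<longleftrightarrow> u \<in> V \<and> v \<in> V \<and>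
    (u = v \<or> \<not> (\<exists>k. max_matching V E k \<and> k u = u \<and> k v = v))" for u v
  have R_refl: "R v v" if "v \<in> V" for v using that by (simp add: R_def)
  have R_sym: "R v u" if "R u v" for u v using that by (auto simp: R_def)
  have R_trans: "R u v" if "R u t" "R t v" for u t v
  proof (rule ccontr)
    assume "\<not> R u v"
    have V: "u \<in> V" "t \<in> V" "v \<in> V" using that by (auto simp: R_def)
    with \<open>\<not> R u v\<close> obtain k where k: "max_matching V E k" "k u = u" "k v = v" and ne: "u \<noteq> v"
      by (auto simp: R_def)
    obtain n where "max_matching V E n" "n t = t" using all V by blast
    \<comment> \<open>Here \<open>k\<close> misses \<open>u\<close> and \<open>v\<close>, and
      \<open>n\<close> misses \<open>t\<close>. Gallai's lemma yields a maximum matching missing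
      \<open>t\<close> together with \<open>u\<close> or \<open>v\<close>, against
      \<open>R u t\<close> or \<open>R t v\<close> unless \<open>t\<close> is one of them.\<close>
    from gallai[OF fin sym k(1) V(1,3) ne k(2,3) V(2) this]
    have "\<exists>k. max_matching V E k \<and> k t = t \<and> (k u = u \<or> k v = v)" .
    then have "t = u \<or> t = v" using that by (auto simp: R_def)
    then show False using that \<open>\<not> R u v\<close> by auto
  qed
  have R_adj: "R u v" if "u \<in> V" "v \<in> V" "E u v" for u v
    using max_matching_nonadjacent[OF fin sym _ that(1,2)] that by (auto simp: R_def)
  \<comment> \<open>Each class is labelled by one of its own elements, so labels stay in
    \<open>V\<close>. Related vertices get the same label, as their predicates under
    \<open>SOME\<close> coincide.\<close>
  define f where "f v = (SOME u. R u v)" for v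
  have f: "R (f v) v" if "v \<in> V" for v
    unfolding f_def using R_refl[OF that] by (rule someI)
  have f_eq: "f u = f v \<longleftrightarrow> R u v" if V: "u \<in> V" "v \<in> V" for u v
  proof
    assume "f u = f v"
    then have "R (f u) v" using f[OF V(2)] by simp
    then show "R u v" by (rule R_trans[OF R_sym[OF f[OF V(1)]]])
  next
    assume uv: "R u v"
    have "R w u = R w v" for w
      using R_trans[OF _ uv] R_trans[OF _ R_sym[OF uv]] by (rule iffI)
    then show "f u = f v" by (simp add: f_def)
  qed
  have f_in: "f v \<in> V" if "v \<in> V" for v using f[OF that] by (simp add: R_def)
  \<comment> \<open>Two unmatched vertices are missed together by \<open>m\<close> itself, so
    related ones are equal.\<close>
  have inj: "inj_on f (unmatched V m)"
  proof (rule inj_onI)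
    fix u v assume "u \<in> unmatched V m" "v \<in> unmatched V m" "f u = f v"
    then show "u = v" using f_eq m by (auto simp: R_def unmatched_def)
  qed
  have odd_class: "odd (card (label_class V {} f (f v)))" if "v \<in> unmatched V m" for v
  proof -
    let ?X = "label_class V {} f (f v)"
    have v: "v \<in> V" "m v = v" using that by (auto simp: unmatched_def)
    have mm: "matching_on V E m" using m by (simp add: max_matching_def)
    \<comment> \<open>By injectivity \<open>v\<close> is the only unmatched vertex of its class, and
      \<open>R_adj\<close> keeps partners inside the class.\<close>
    have "even (card (?X - {v}))"
    proof (rule even_card_involution)
      show "finite (?X - {v})" using fin by (simp add: label_class_def)
      fix w assume "w \<in> ?X - {v}"
      then have w: "w \<in> V" "f w = f v" "w \<noteq> v" by (auto simp: label_class_def)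
      have mw: "m w \<noteq> w"
      proof
        assume "m w = w"
        then have "w \<in> unmatched V m" using w by (simp add: unmatched_def)
        then show False using inj w that by (auto dest: inj_onD)
      qed
      then have "E w (m w)" "m (m w) = w" using mm by (auto simp: matching_on_def)
      moreover have "m w \<in> V" using matching_on_in[OF mm w(1)] .
      moreover have "f (m w) = f v" using calculation R_adj f_eq w by metis
      moreover have "m w \<noteq> v"
      proof
        assume "m w = v"
        then have "w = m v" using \<open>m (m w) = w\<close> by simp
        then show False using v w by simp
      qed
      ultimately show "m w \<in> ?X - {v} \<and> m (m w) = w \<and> m w \<noteq> w"
        using mw by (auto simp: label_class_def)
    qed
    moreover have "card ?X = Suc (card (?X - {v}))"
      using v fin by (intro card.remove) (auto simp: label_class_def)
    ultimately show ?thesis by (simp only: even_Suc not_not)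
  qed
  have "card (unmatched V m) = card (f ` unmatched V m)"
    using inj by (simp add: card_image)
  also have "\<dots> \<le> card {i \<in> V. odd (card (label_class V {} f i))}"
    using fin odd_class f_in by (intro card_mono) (auto simp: unmatched_def)
  finally have "card (unmatched V m) \<le> card {i \<in> V. odd (card (label_class V {} f i))}" .
  moreover have "edge_constant V E f" using R_adj f_eq by (auto simp: edge_constant_def)
  ultimately show ?thesis using f_in by blast
qed

text \<open>A vertex missed by \<open>m\<close> makes the odd classes outnumber \<open>S\<close>,
  the violation that \<open>TutteCondition\<close> asks for. Labels are kept in \<open>V\<close> so
  that at most \<open>card V\<close> of them occur, as many as the encoding has component
  indices.\<close>

theorem tutte_berge:
  assumes "finite V" "symp E" "max_matching V E m"
  shows "\<exists>S f. S \<subseteq> V \<and> f ` (V - S) \<subseteq> V \<and> edge_constant (V - S) E f \<and>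
    card S + card (unmatched V m) \<le> card {i \<in> V. odd (card (label_class V S f i))}"
  using assms
proof (induction V arbitrary: m rule: finite_psubset_induct)
  case (psubset V)
  note fin = psubset.hyps and sym = psubset.prems(1) and m = psubset.prems(2)
  show ?case
  proof (cases "\<forall>v\<in>V. \<exists>n. max_matching V E n \<and> n v = v")
    case True
    then obtain f where f: "f ` V \<subseteq> V" "edge_constant V E f"
      "card (unmatched V m) \<le> card {i \<in> V. odd (card (label_class V {} f i))}"
      using tutte_berge_no_essential[OF fin sym m] by blast
    show ?thesis using f by (intro exI[of _ "{}"] exI[of _ f]) simp
  next
    case False
    then obtain v where v: "v \<in> V" and ess: "\<And>n. max_matching V E n \<Longrightarrow> n v \<noteq> v" by blast
    let ?W = "V - {v}"
    obtain n where n: "max_matching ?W E n" using ex_max_matching by blast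
    have nV: "matching_on V E n" and nv: "n v = v"
      using n matching_on_mono by (auto simp: max_matching_def matching_on_def)
    \<comment> \<open>As \<open>n\<close> misses the essential vertex \<open>v\<close>, it is not
      maximum on \<open>V\<close> and misses more vertices than \<open>m\<close>, by parity at least
      two more. Not counting \<open>v\<close>, one extra vertex remains, which pays for adding
      \<open>v\<close> to the barrier.\<close>
    have "\<not> card (unmatched V n) \<le> card (unmatched V m)"
      using max_matchingI[OF m nV] ess nv by blast
    moreover have "unmatched V n = insert v (unmatched ?W n)" "v \<notin> unmatched ?W n"
      using v nv by (auto simp: unmatched_def)
    then have "card (unmatched V n) = Suc (card (unmatched ?W n))" using fin by simp
    moreover have "even (card V - card (unmatched V n))" "even (card V - card (unmatched V m))"
      using even_card_matched[OF fin] nV m by (auto simp: max_matching_def)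
    moreover have "card (unmatched V n) \<le> card V" "card (unmatched V m) \<le> card V"
      using fin by (auto intro!: card_mono simp: unmatched_def)
    ultimately have less: "Suc (card (unmatched V m)) \<le> card (unmatched ?W n)"
      by (cases "card (unmatched ?W n) = card (unmatched V m)") auto
    obtain S f where Sf: "S \<subseteq> ?W" "f ` (?W - S) \<subseteq> ?W" "edge_constant (?W - S) E f"
      "card S + card (unmatched ?W n) \<le> card {i \<in> ?W. odd (card (label_class ?W S f i))}"
      using psubset.IH[OF _ sym n] v by blast
    have eq: "?W - S = V - insert v S" by blast
    have "{i \<in> ?W. odd (card (label_class ?W S f i))} \<subseteq>
        {i \<in> V. odd (card (label_class V (insert v S) f i))}"
      unfolding label_class_def eq by blast
    then have "card {i \<in> ?W. odd (card (label_class ?W S f i))} \<le>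
        card {i \<in> V. odd (card (label_class V (insert v S) f i))}"
      using fin by (intro card_mono) auto
    moreover have "card (insert v S) = Suc (card S)"
      using Sf(1) fin finite_subset[of S V] by (subst card_insert_disjoint) auto
    ultimately have "card (insert v S) + card (unmatched V m) \<le>
        card {i \<in> V. odd (card (label_class V (insert v S) f i))}"
      using Sf(4) less by linarith
    moreover have "insert v S \<subseteq> V" "f ` (V - insert v S) \<subseteq> V"
      "edge_constant (V - insert v S) E f"
      using Sf v unfolding eq by auto
    ultimately show ?thesis by blast
  qed
qed

section \<open>Matchings inducing a given coloring\<close>

text \<open>The ordinary graph belonging to \<open>c\<close>. Two vertices and their colors
  determine an edge, so no parallel edges get lost in passing to a relation.\<close>

definition colored_adj :: "'v bicolored_graph \<Rightarrow> ('v \<Rightarrow> nat) \<Rightarrow> 'v \<Rightarrow> 'v \<Rightarrow> bool" where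
  "colored_adj G c u v \<longleftrightarrow> {(u, c u), (v, c v)} \<in> edges G"

lemma symp_colored_adj: "symp (colored_adj G c)"
  by (simp add: symp_def colored_adj_def insert_commute)

section \<open>Edges and inherited colors at a vertex\<close>

lemma bicolored_graph_ends:
  assumes "bicolored_graph G" "{(u, a), (v, b)} \<in> edges G"
  shows "u \<in> verts G" "v \<in> verts G" "u \<noteq> v"
  using assms unfolding bicolored_graph_def by (auto simp: doubleton_eq_iff)

lemma bicolored_graph_edge_at:
  assumes "bicolored_graph G" "e \<in> edges G" "incident v e"
  obtains a w b where "e = {(v, a), (w, b)}" "w \<in> verts G" "w \<noteq> v"
proof -
  have "\<exists>u\<in>verts G. \<exists>v\<in>verts G. \<exists>a\<in>{1..ncolors G}. \<exists>b\<in>{1..ncolors G}.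
      u \<noteq> v \<and> e = {(u, a), (v, b)}"
    using assms(1,2) unfolding bicolored_graph_def by simp
  then obtain x y a b where xy: "x \<in> verts G" "y \<in> verts G" "x \<noteq> y" "e = {(x, a), (y, b)}"
    by auto
  then consider "v = x" | "v = y" using assms(3) by (auto simp: incident_def)
  then show thesis
  proof cases
    case 1
    then show thesis using that[of a y b] xy by simp
  next
    case 2
    then show thesis using that[of b x a] xy by (simp add: insert_commute)
  qed
qed

lemma inherited_coloring_eq:
  assumes P: "perfect_matching G P" and v: "v \<in> verts G"
    and e: "{(v, a), (w, b)} \<in> P" "w \<noteq> v"
  shows "inherited_coloring G P v = a"
proof -
  have ex1: "\<exists>!e. e \<in> P \<and> incident v e" using P v by (simp add: perfect_matching_def)
  have "(THE e. e \<in> P \<and> incident v e) = {(v, a), (w, b)}"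
    using e by (intro the1_equality[OF ex1]) (auto simp: incident_def)
  moreover have "end_color {(v, a), (w, b)} v = a"
    using e(2) unfolding end_color_def by (intro the_equality) auto
  ultimately show ?thesis using v by (simp add: inherited_coloring_def)
qed

lemma matching_on_of_perfect_matching:
  assumes G: "bicolored_graph G" and P: "perfect_matching G P"
    and c: "inherited_coloring G P = c"
  shows "\<exists>m. matching_on (verts G) (colored_adj G c) m \<and> unmatched (verts G) m = {}"
proof -
  have sub: "P \<subseteq> edges G" using P by (simp add: perfect_matching_def)
  have "\<exists>w. w \<in> verts G \<and> w \<noteq> v \<and> {(v, c v), (w, c w)} \<in> P" if v: "v \<in> verts G" for v
  proof -
    \<comment> \<open>The matching edge at \<open>v\<close> carries the colors of \<open>c\<close>
      at both ends because \<open>c\<close> is inherited from \<open>P\<close>.\<close>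
    obtain e where e: "e \<in> P" "incident v e"
      using P v unfolding perfect_matching_def by blast
    then obtain a w b where w: "e = {(v, a), (w, b)}" "w \<in> verts G" "w \<noteq> v"
      using bicolored_graph_edge_at[OF G] sub by blast
    have "c v = a" using inherited_coloring_eq[OF P v] e(1) w c by blast
    moreover have "c w = b"
      using inherited_coloring_eq[OF P w(2), of b v a] e(1) w c by (simp add: insert_commute)
    ultimately show ?thesis using w e by blast
  qed
  then obtain m0 where m0: "\<And>v. v \<in> verts G \<Longrightarrow>
      m0 v \<in> verts G \<and> m0 v \<noteq> v \<and> {(v, c v), (m0 v, c (m0 v))} \<in> P"
    by metis
  \<comment> \<open>\<open>m0\<close> is only controlled on \<open>verts G\<close>; the identity
    elsewhere makes \<open>m\<close> an involution of the whole type.\<close>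
  define m where "m v = (if v \<in> verts G then m0 v else v)" for v
  have "m (m v) = v" if v: "v \<in> verts G" for v
  proof -
    let ?w = "m0 v"
    have w: "?w \<in> verts G" using m0[OF v] by simp
    have "\<exists>!e. e \<in> P \<and> incident ?w e" using P w by (simp add: perfect_matching_def)
    then have unique: "e1 = e2"
      if "e1 \<in> P" "incident ?w e1" "e2 \<in> P" "incident ?w e2" for e1 e2
      using that by blast
    have inc: "incident ?w {(v, c v), (?w, c ?w)}"
      "incident ?w {(?w, c ?w), (m0 ?w, c (m0 ?w))}"
      by (auto simp: incident_def)
    \<comment> \<open>Both edges belong to \<open>P\<close> and meet \<open>?w\<close>, so they
      coincide and the partner of \<open>?w\<close> is \<open>v\<close>.\<close>
    have "{(v, c v), (?w, c ?w)} = {(?w, c ?w), (m0 ?w, c (m0 ?w))}"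
    proof (rule unique[OF _ inc(1) _ inc(2)])
      show "{(v, c v), (?w, c ?w)} \<in> P" using m0[OF v] by blast
      show "{(?w, c ?w), (m0 ?w, c (m0 ?w))} \<in> P" using m0[OF w] by blast
    qed
    then have "m0 ?w = v"
      using m0[OF v] unfolding doubleton_eq_iff prod.inject by metis
    then show ?thesis using v w by (simp add: m_def)
  qed
  then have "matching_on (verts G) (colored_adj G c) m"
    using m0 sub by (auto simp: matching_on_def colored_adj_def m_def)
  moreover have "unmatched (verts G) m = {}" using m0 by (auto simp: unmatched_def m_def)
  ultimately show ?thesis by blast
qed

lemma perfect_matching_of_matching_on:
  assumes c: "c \<in> vertex_colorings G"
    and m: "matching_on (verts G) (colored_adj G c) m" "unmatched (verts G) m = {}"
  shows "\<exists>P. perfect_matching G P \<and> inherited_coloring G P = c"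
proof -
  define edge where "edge v = {(v, c v), (m v, c (m v))}" for v
  let ?P = "edge ` verts G"
  have minv: "m (m v) = v" for v using m(1) by (simp add: matching_on_def)
  have mne: "m v \<noteq> v" if "v \<in> verts G" for v using m(2) that by (auto simp: unmatched_def)
  \<comment> \<open>The two ends of a matched pair produce the same edge; hence \<open>?P\<close>
    has only one edge at each vertex.\<close>
  have edge_m: "edge (m v) = edge v" for v by (simp add: edge_def minv insert_commute)
  have unique: "e = edge v" if "e \<in> ?P" "incident v e" for e v
    using that edge_m by (auto simp: incident_def edge_def)
  have "?P \<subseteq> edges G"
    using m(1) mne by (auto simp: matching_on_def colored_adj_def edge_def)
  moreover have "\<exists>!e. e \<in> ?P \<and> incident v e" if "v \<in> verts G" for v
  proof (rule ex1I[of _ "edge v"])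
    show "edge v \<in> ?P \<and> incident v (edge v)"
      using that by (auto simp: incident_def edge_def)
    show "e = edge v" if "e \<in> ?P \<and> incident v e" for e using that unique by blast
  qed
  ultimately have P: "perfect_matching G ?P" by (simp add: perfect_matching_def)
  have "inherited_coloring G ?P = c"
  proof
    fix v
    show "inherited_coloring G ?P v = c v"
    proof (cases "v \<in> verts G")
      case True
      then have "{(v, c v), (m v, c (m v))} \<in> ?P" by (auto simp: edge_def)
      then show ?thesis by (rule inherited_coloring_eq[OF P True _ mne[OF True]])
    next
      case False
      \<comment> \<open>Off \<open>verts G\<close> both functions take the default
        \<open>undefined\<close>: \<open>c\<close> is extensional, and
        \<open>inherited_coloring\<close> is restricted.\<close>
      then have "c v = undefined"
        using c unfolding vertex_colorings_def by (rule PiE_arb[rotated])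
      with False show ?thesis by (simp add: inherited_coloring_def)
    qed
  qed
  with P show ?thesis by blast
qed

section \<open>Assignments of the encoding\<close>

lemma satisfies_setcompr_iff:
  "satisfies A {F x |x. x \<in> X} \<longleftrightarrow> (\<forall>x\<in>X. F x A)"
  unfolding satisfies_def by blast

lemma satisfies_setcompr4_iff:
  "satisfies A {F u a v b |u a v b. Q u a v b} \<longleftrightarrow>
    (\<forall>u a v b. Q u a v b \<longrightarrow> F u a v b A)"
  unfolding satisfies_def by blast

lemma satisfies_ValidColoring_iff:
  "satisfies A (ValidColoring G) \<longleftrightarrow>
    (\<forall>v\<in>verts G. \<exists>!i. i \<in> {1..ncolors G} \<and> A (VC v i))"
proof -
  have vc: "ExactOne {VC v i |i. i \<in> {1..ncolors G}} A \<longleftrightarrow>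
      (\<exists>!i. i \<in> {1..ncolors G} \<and> A (VC v i))" for v
    unfolding ExactOne_def by blast
  show ?thesis unfolding vc[symmetric] ValidColoring_def by (rule satisfies_setcompr_iff)
qed

text \<open>Both directions work with this form: exclusive or has become parity, sums have become
  cardinalities, and the component condition is split by whether \<open>v\<close> is in the
  barrier.\<close>

lemma satisfies_TutteEncoding_iff:
  assumes "finite (verts G)"
  shows "satisfies A (TutteEncoding G \<Lambda>) \<longleftrightarrow>
    (\<forall>v\<in>verts G. \<exists>!i. i \<in> {1..ncolors G} \<and> A (VC v i)) \<and>
    satisfies A \<Lambda> \<and>
    (\<forall>u a v b. {(u, a), (v, b)} \<in> edges G \<longrightarrow>
      (A (Edge {(u, a), (v, b)}) \<longleftrightarrow> \<not> A (T v) \<and> \<not> A (T u) \<and> A (VC u a) \<and> A (VC v b)) \<and>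
      (A (Edge {(u, a), (v, b)}) \<longrightarrow>
        (\<forall>i\<in>{1..card (verts G)}. A (CC v i) \<longleftrightarrow> A (CC u i)))) \<and>
    (\<forall>v\<in>verts G. if A (T v) then \<forall>i\<in>{1..card (verts G)}. \<not> A (CC v i)
      else \<exists>!i. i \<in> {1..card (verts G)} \<and> A (CC v i)) \<and>
    (\<forall>i\<in>{1..card (verts G)}. A (Odd i) \<longleftrightarrow> odd (card {v \<in> verts G. A (CC v i)})) \<and>
    card {v \<in> verts G. A (T v)} < card {i \<in> {1..card (verts G)}. A (Odd i)}"
proof -
  let ?n = "card (verts G)"
  have cc: "ExactOne ({CC v i |i. i \<in> {1..?n}} \<union> {T v}) A \<longleftrightarrow>
      (if A (T v) then \<forall>i\<in>{1..?n}. \<not> A (CC v i) else \<exists>!i. i \<in> {1..?n} \<and> A (CC v i))" for v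
  proof (cases "A (T v)")
    case True
    then have "ExactOne ({CC v i |i. i \<in> {1..?n}} \<union> {T v}) A \<longleftrightarrow>
        (\<forall>i\<in>{1..?n}. \<not> A (CC v i))"
      unfolding ExactOne_def by blast
    then show ?thesis using True by simp
  next
    case False
    then have "ExactOne ({CC v i |i. i \<in> {1..?n}} \<union> {T v}) A \<longleftrightarrow>
        ExactOne {CC v i |i. i \<in> {1..?n}} A"
      unfolding ExactOne_def by (intro arg_cong[where f = Ex1] ext) auto
    also have "\<dots> \<longleftrightarrow> (\<exists>!i. i \<in> {1..?n} \<and> A (CC v i))"
      unfolding ExactOne_def by blast
    finally show ?thesis using False by simp
  qed
  have cond: "TutteCondition G A \<longleftrightarrow>
      card {v \<in> verts G. A (T v)} < card {i \<in> {1..?n}. A (Odd i)}"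
    using assms by (simp add: TutteCondition_def Int_def sum_of_bool_eq)
  have "satisfies A (RemainingEdges G) \<longleftrightarrow>
      (\<forall>u a v b. {(u, a), (v, b)} \<in> edges G \<longrightarrow>
      (A (Edge {(u, a), (v, b)}) \<longleftrightarrow> \<not> A (T v) \<and> \<not> A (T u) \<and> A (VC u a) \<and> A (VC v b)))"
    unfolding RemainingEdges_def by (rule satisfies_setcompr4_iff)
  moreover have "satisfies A (ConnectedComponent G) \<longleftrightarrow>
      (\<forall>u a v b. {(u, a), (v, b)} \<in> edges G \<longrightarrow> A (Edge {(u, a), (v, b)}) \<longrightarrow>
        (\<forall>i\<in>{1..?n}. A (CC v i) \<longleftrightarrow> A (CC u i)))"
    unfolding ConnectedComponent_def by (rule satisfies_setcompr4_iff)
  moreover have "satisfies A (ValidComponent G) \<longleftrightarrow>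
      (\<forall>v\<in>verts G. if A (T v) then \<forall>i\<in>{1..?n}. \<not> A (CC v i)
        else \<exists>!i. i \<in> {1..?n} \<and> A (CC v i))"
    unfolding cc[symmetric] ValidComponent_def by (rule satisfies_setcompr_iff)
  moreover have "satisfies A (OddConstraint G) \<longleftrightarrow>
      (\<forall>i\<in>{1..?n}. A (Odd i) \<longleftrightarrow> odd (card {v \<in> verts G. A (CC v i)}))"
    unfolding big_xor_iff_odd[OF assms, symmetric] OddConstraint_def
    by (rule satisfies_setcompr_iff)
  moreover have "satisfies A (TutteEncoding G \<Lambda>) \<longleftrightarrow>
      satisfies A (ValidColoring G) \<and> satisfies A \<Lambda> \<and>
      satisfies A (RemainingEdges G) \<and> satisfies A (ConnectedComponent G) \<and>
      satisfies A (ValidComponent G) \<and> satisfies A (OddConstraint G) \<and> TutteCondition G A"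
    unfolding TutteEncoding_def satisfies_def ball_Un by auto
  ultimately show ?thesis
    unfolding cond satisfies_ValidColoring_iff by (simp only: imp_conjR all_conj_distrib conj_assoc)
qed

text \<open>The \<open>VC\<close> variables give a coloring, the \<open>T\<close> variables a
  barrier and the \<open>CC\<close> variables the labels. A perfect matching inheriting the coloring
  would contradict \<open>odd_classes_le_card\<close>.\<close>

lemma no_perfect_matching_of_satisfies:
  assumes G: "bicolored_graph G" and C: "defines_colorings G C \<Lambda>"
    and A: "satisfies A (TutteEncoding G \<Lambda>)"
  shows "\<exists>c\<in>C. \<not> (\<exists>P. perfect_matching G P \<and> inherited_coloring G P = c)"
proof -
  let ?V = "verts G" and ?I = "{1..card (verts G)}"
  have fin: "finite ?V" using G by (simp add: bicolored_graph_def)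
  note A' = A[unfolded satisfies_TutteEncoding_iff[OF fin]]
  note vcA = A'[THEN conjunct1] and A1 = A'[THEN conjunct2]
  note \<Lambda> = A1[THEN conjunct1] and A2 = A1[THEN conjunct2]
  note edgeA = A2[THEN conjunct1, rule_format] and A3 = A2[THEN conjunct2]
  note ccA = A3[THEN conjunct1] and A4 = A3[THEN conjunct2]
  note oddA = A4[THEN conjunct1] and lessA = A4[THEN conjunct2]
  define c where "c = (\<lambda>v\<in>?V. THE i. i \<in> {1..ncolors G} \<and> A (VC v i))"
  \<comment> \<open>On barrier vertices no index is set and the value of \<open>f\<close> is
    unspecified; only its values off \<open>S\<close> matter.\<close>
  define f where "f v = (THE i. i \<in> ?I \<and> A (CC v i))" for v
  define S where "S = {v \<in> ?V. A (T v)}"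
  have c: "c v \<in> {1..ncolors G}" "A (VC v (c v))" if "v \<in> ?V" for v
  proof -
    have "\<exists>!i. i \<in> {1..ncolors G} \<and> A (VC v i)" using vcA that by blast
    from theI'[OF this] show "c v \<in> {1..ncolors G}" "A (VC v (c v))"
      using that by (simp_all add: c_def)
  qed
  have "c \<in> vertex_colorings G"
    unfolding vertex_colorings_def using c(1) by (intro PiE_I) (auto simp: c_def)
  moreover have "satisfies A (ValidColoring G)"
    using vcA unfolding satisfies_ValidColoring_iff .
  moreover have "\<forall>v\<in>?V. \<forall>i\<in>{1..ncolors G}. c v = i \<longleftrightarrow> A (VC v i)"
    using c vcA by blast
  ultimately have "c \<in> C" using C \<Lambda> unfolding defines_colorings_def by blast
  have cc1: "\<exists>!i. i \<in> ?I \<and> A (CC v i)" if "v \<in> ?V - S" for v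
    using bspec[OF ccA, of v] that by (simp add: S_def)
  have f: "f v = i \<longleftrightarrow> A (CC v i)" if "v \<in> ?V - S" "i \<in> ?I" for v i
    using theI'[OF cc1[OF that(1)]] cc1[OF that(1)] that(2) unfolding f_def by blast
  have f_in: "f v \<in> ?I" if "v \<in> ?V - S" for v
    using theI'[OF cc1[OF that]] unfolding f_def by blast
  have "edge_constant (?V - S) (colored_adj G c) f"
    unfolding edge_constant_def
  proof (intro ballI impI)
    fix u v assume uv: "u \<in> ?V - S" "v \<in> ?V - S" and E: "colored_adj G c u v"
    then have "{(u, c u), (v, c v)} \<in> edges G" by (simp add: colored_adj_def)
    \<comment> \<open>Both ends lie off the barrier and have the colors of the edge, so
      \<open>RemainingEdges\<close> makes its variable true and \<open>ConnectedComponent\<close>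
      equates the indices.\<close>
    moreover have "\<not> A (T v) \<and> \<not> A (T u) \<and> A (VC u (c u)) \<and> A (VC v (c v))"
      using uv c by (auto simp: S_def)
    ultimately have "\<forall>i\<in>?I. A (CC v i) \<longleftrightarrow> A (CC u i)" using edgeA by meson
    then show "f u = f v" using f[OF uv(1)] f[OF uv(2)] f_in[OF uv(2)] by blast
  qed
  moreover have "card S < card {i \<in> ?I. odd (card (label_class ?V S f i))}"
  proof -
    have "{v \<in> ?V. A (CC v i)} = label_class ?V S f i" if "i \<in> ?I" for i
      
    proof -
      \<comment> \<open>\<open>ValidComponent\<close> leaves barrier vertices without an index, so
        counting \<open>CC v i\<close> over all vertices counts exactly the label class off
        \<open>S\<close>.\<close>
      have "\<not> A (CC v i)" if "v \<in> S" for v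
        using bspec[OF ccA, of v] that \<open>i \<in> ?I\<close> by (simp add: S_def)
      then show ?thesis using f[OF _ that] unfolding label_class_def by blast
    qed
    then have "{i \<in> ?I. A (Odd i)} = {i \<in> ?I. odd (card (label_class ?V S f i))}"
      using oddA by auto
    then show ?thesis using lessA by (simp add: S_def)
  qed
  ultimately have "\<not> (\<exists>m. matching_on ?V (colored_adj G c) m \<and> unmatched ?V m = {})"
    using odd_classes_le_card[OF fin, of S "colored_adj G c" _ f ?I]
    by (metis (no_types, lifting) S_def leD mem_Collect_eq subsetI)
  then show ?thesis using \<open>c \<in> C\<close> matching_on_of_perfect_matching[OF G] by blast
qed

text \<open>Inverse of the reading in \<open>no_perfect_matching_of_satisfies\<close>. An edge
  variable is indexed by an unordered edge, hence its ends are quantified.\<close>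

fun barrier_assignment ::
  "'v set \<Rightarrow> ('v \<Rightarrow> nat) \<Rightarrow> 'v set \<Rightarrow> ('v \<Rightarrow> nat) \<Rightarrow> 'v tutte_var \<Rightarrow> bool" where
  "barrier_assignment V c S f (VC v i) \<longleftrightarrow> c v = i"
| "barrier_assignment V c S f (T v) \<longleftrightarrow> v \<in> S"
| "barrier_assignment V c S f (Edge e) \<longleftrightarrow>
     (\<exists>u v. e = {(u, c u), (v, c v)} \<and> u \<notin> S \<and> v \<notin> S)"
| "barrier_assignment V c S f (CC v i) \<longleftrightarrow> v \<notin> S \<and> f v = i"
| "barrier_assignment V c S f (Odd i) \<longleftrightarrow> odd (card (label_class V S f i))"

lemma satisfies_barrier_assignment:
  assumes G: "bicolored_graph G" and C: "C \<subseteq> vertex_colorings G"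
    "defines_colorings G C \<Lambda>" and c: "c \<in> C"
    and S: "S \<subseteq> verts G" and f: "f ` (verts G - S) \<subseteq> {1..card (verts G)}"
      "edge_constant (verts G - S) (colored_adj G c) f"
    and less: "card S < card {i \<in> {1..card (verts G)}. odd (card (label_class (verts G) S f i))}"
  shows "satisfies (barrier_assignment (verts G) c S f) (TutteEncoding G \<Lambda>)"
proof -
  let ?V = "verts G" and ?A = "barrier_assignment (verts G) c S f"
  have fin: "finite ?V" using G by (simp add: bicolored_graph_def)
  have c_in: "c v \<in> {1..ncolors G}" if "v \<in> ?V" for v
    using C(1) c that unfolding vertex_colorings_def by (blast dest: PiE_mem)
  have "satisfies ?A (ValidColoring G)"
    using c_in by (auto simp: satisfies_ValidColoring_iff)
  then have \<Lambda>: "satisfies ?A \<Lambda>" using C c by (auto simp: defines_colorings_def)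
  \<comment> \<open>The unordered edge may be read in either direction, but the condition is
    symmetric under swapping the ends, so both readings agree.\<close>
  have edge: "?A (Edge {(u, a), (v, b)}) \<longleftrightarrow> v \<notin> S \<and> u \<notin> S \<and> c u = a \<and> c v = b" for u a v b
    by (auto simp: doubleton_eq_iff)
  have con: "f u = f v"
    if "{(u, a), (v, b)} \<in> edges G" "v \<notin> S \<and> u \<notin> S \<and> c u = a \<and> c v = b" for u a v b
    using f(2) that bicolored_graph_ends[OF G that(1)]
    by (auto simp: edge_constant_def colored_adj_def)
  have "{v \<in> ?V. v \<in> S} = S" using S by blast
  moreover have "{v \<in> ?V. v \<notin> S \<and> f v = i} = label_class ?V S f i" for i
    by (auto simp: label_class_def)
  ultimately show ?thesis
    unfolding satisfies_TutteEncoding_iff[OF fin] edge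
    using \<Lambda> con less c_in f(1) by (auto split: if_splits)
qed

text \<open>A maximum matching of the graph of \<open>c\<close> misses some vertex, so Tutte-Berge
  gives strictly more odd classes than barrier vertices.\<close>

lemma satisfiable_of_no_perfect_matching:
  assumes G: "bicolored_graph G" and C: "C \<subseteq> vertex_colorings G" "defines_colorings G C \<Lambda>"
    and c: "c \<in> C" and no: "\<not> (\<exists>P. perfect_matching G P \<and> inherited_coloring G P = c)"
  shows "satisfiable (TutteEncoding G \<Lambda>)"
proof -
  let ?V = "verts G" and ?I = "{1..card (verts G)}"
  have fin: "finite ?V" using G by (simp add: bicolored_graph_def)
  obtain m where m: "max_matching ?V (colored_adj G c) m" using ex_max_matching by blast
  then have "unmatched ?V m \<noteq> {}"
    using no perfect_matching_of_matching_on C c unfolding max_matching_def by blast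
  then have pos: "0 < card (unmatched ?V m)" using fin by (simp add: card_gt_0_iff)
  obtain S f where S: "S \<subseteq> ?V" and f: "f ` (?V - S) \<subseteq> ?V"
    "edge_constant (?V - S) (colored_adj G c) f"
    and le: "card S + card (unmatched ?V m) \<le> card {i \<in> ?V. odd (card (label_class ?V S f i))}"
    using tutte_berge[OF fin symp_colored_adj m] by blast
  \<comment> \<open>The labels from Tutte-Berge are vertices; \<open>g\<close> renumbers them by the
    component indices of the encoding.\<close>
  obtain g where g: "bij_betw g ?V ?I"
    using ex_bij_betw_nat_finite_1[OF fin] bij_betw_inv by blast
  have inj: "inj_on g ?V" using g by (rule bij_betw_imp_inj_on)
  let ?gf = "\<lambda>v. g (f v)"
  have "label_class ?V S ?gf (g i) = label_class ?V S f i" if "i \<in> ?V" for i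
    using that f(1) inj by (auto simp: label_class_def dest: inj_onD)
  then have "g ` {i \<in> ?V. odd (card (label_class ?V S f i))} \<subseteq>
      {i \<in> ?I. odd (card (label_class ?V S ?gf i))}"
    using bij_betwE[OF g] by auto
  then have "card {i \<in> ?V. odd (card (label_class ?V S f i))} \<le>
      card {i \<in> ?I. odd (card (label_class ?V S ?gf i))}"
    by (intro card_inj_on_le[of g] inj_on_subset[OF inj]) auto
  then have "card S < card {i \<in> ?I. odd (card (label_class ?V S ?gf i))}"
    using le pos by linarith
  moreover have "?gf ` (?V - S) \<subseteq> ?I" using f(1) bij_betwE[OF g] by blast
  moreover have "edge_constant (?V - S) (colored_adj G c) ?gf"
    using f(2) by (auto simp: edge_constant_def)
  ultimately show ?thesis
    using satisfies_barrier_assignment[OF G C c S] unfolding satisfiable_def by blast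
qed

theorem proposition3:
  fixes G :: "'v bicolored_graph"
    and C :: "('v \<Rightarrow> nat) set"
    and \<Lambda> :: "'v tutte_var constraint set"
  assumes "bicolored_graph G"
    and "C \<subseteq> vertex_colorings G"
    and "defines_colorings G C \<Lambda>"
  shows "(satisfiable (TutteEncoding G \<Lambda>) \<longleftrightarrow> \<not> forall_pmvc G C) \<and>
         (satisfiable (TutteEncoding G \<Lambda>) \<longleftrightarrow>
            (\<exists>c\<in>C. \<not> (\<exists>P. perfect_matching G P \<and> inherited_coloring G P = c)))"
proof -
  have "satisfiable (TutteEncoding G \<Lambda>) \<longleftrightarrow>
      (\<exists>c\<in>C. \<not> (\<exists>P. perfect_matching G P \<and> inherited_coloring G P = c))"
    using no_perfect_matching_of_satisfies[OF assms(1,3)]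
      satisfiable_of_no_perfect_matching[OF assms] unfolding satisfiable_def by blast
  then show ?thesis unfolding forall_pmvc_def by blast
qed

end
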